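(* Let $A\in\mathbb{R}^{m\times n}$ with $m<n$, and let $b\in\mathrm{range}(A)$. Let $W=(B^\top B)^{-1}\in\mathbb{R}^{n\times n}$, where $B^\top B\in\mathbb{R}^{n\times n}$ is nonsingular. Let $S_k\in\mathbb{R}^{m\times k}$, $k=1,\dots,m-1$, be full-rank matrices and let $S_m\in\mathbb{R}^{m\times m}$ be nonsingular. Given $x_0\in\mathbb{R}^n$, let $$x_k=x_{k-1}+p_k,\qquad p_k=WA^\top S_k\,(S_k^\top A W A^\top S_k)^{\dagger}S_k^\top(b-Ax_{k-1}),\qquad k=1,\dots,m.$$ Then $x_m$ solves $Ax=b$.
   Context: All matrices and vectors are real. $(\cdot)^\dagger$ denotes the Moore–Penrose pseudo-inverse (it coincides with the inverse when the matrix is nonsingular). Since $W=(B^\top B)^{-1}$, $W$ is symmetric positive definite. *)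

theory Defs
  imports "Jordan_Normal_Form.DL_Rank"
begin

text \<open>The Moore-Penrose pseudo-inverse of a real matrix is the unique matrix satisfying the four
  Penrose equations. The carrier condition is needed because the dimensions of a value of
  type \<^typ>\<open>real mat\<close> are not determined by its type.\<close>

definition is_pseudo_inverse :: "real mat \<Rightarrow> real mat \<Rightarrow> bool" where
  "is_pseudo_inverse G X \<longleftrightarrow>
     X \<in> carrier_mat (dim_col G) (dim_row G) \<and>
     G * X * G = G \<and> X * G * X = X \<and>
     (G * X)\<^sup>T = G * X \<and> (X * G)\<^sup>T = X * G"

definition pseudo_inverse :: "real mat \<Rightarrow> real mat" where
  "pseudo_inverse G = (THE X. is_pseudo_inverse G X)"

end

theory Submission
  imports Defs
begin

text \<open>Only the last step matters, and there only the nonsingularity of \<open>S\<^sub>m\<close>.  Put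
  \<open>C = A\<^sup>T S\<^sub>m\<close>, \<open>D = B W C\<close> and \<open>M = C\<^sup>T W C = D\<^sup>T D\<close>.  Since \<open>M M\<^sup>\<dagger>\<close> is symmetric and fixes \<open>M\<close>,
  cancelling \<open>D\<^sup>T\<close> shows that it fixes \<open>D\<^sup>T\<close>, hence also \<open>C\<^sup>T = D\<^sup>T B\<close>.  For a residual
  \<open>b - A x\<^bsub>m-1\<^esub> = A v\<close> this gives
  \<open>S\<^sub>m\<^sup>T A p\<^sub>m = M M\<^sup>\<dagger> C\<^sup>T v = C\<^sup>T v = S\<^sub>m\<^sup>T A v\<close>, and \<open>S\<^sub>m\<^sup>T\<close> can be cancelled.\<close>

text \<open>Premises in terms of dimensions let the simplifier reassociate without having to guess
  carrier sizes.\<close>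

lemma assoc_mult_mat_dim:
  fixes A B C :: "'a :: semiring_0 mat"
  assumes "dim_col A = dim_row B" "dim_col B = dim_row C"
  shows "A * B * C = A * (B * C)"
  using assms by (intro assoc_mult_mat) auto

lemma transpose_mult_dim:
  fixes A B :: "'a :: comm_semiring_0 mat"
  assumes "dim_col A = dim_row B"
  shows "(A * B)\<^sup>T = B\<^sup>T * A\<^sup>T"
  using assms by (intro transpose_mult) auto

section \<open>Cancellation in real Gram matrices\<close>

text \<open>The diagonal entries of \<open>D\<^sup>T * D\<close> are the squared norms of the
  columns of \<open>D\<close>.\<close>

lemma transpose_mult_self_eq_0:
  fixes D :: "real mat"
  assumes D: "D \<in> carrier_mat r c" and 0: "D\<^sup>T * D = 0\<^sub>m c c"
  shows "D = 0\<^sub>m r c"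
proof (rule eq_matI)
  fix i j assume ij: "i < dim_row (0\<^sub>m r c)" "j < dim_col (0\<^sub>m r c)"
  have "col D j \<bullet> col D j = (D\<^sup>T * D) $$ (j, j)" using ij D by simp
  also have "\<dots> = 0" using 0 ij by simp
  finally have "col D j = 0\<^sub>v r"
    using conjugate_square_eq_0_vec[of "col D j" r] D by auto
  hence "col D j $ i = 0\<^sub>v r $ i" by (rule arg_cong)
  thus "D $$ (i, j) = 0\<^sub>m r c $$ (i, j)" using ij D by simp
qed (use D in auto)

text \<open>With \<open>E = D * Y - D * Z = D * (Y - Z)\<close>, the hypothesis says
  \<open>D\<^sup>T * E = 0\<close>, so
  \<open>E\<^sup>T * E = (Y - Z)\<^sup>T * (D\<^sup>T * E) = 0\<close> and hence
  \<open>E = 0\<close>.\<close>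

lemma transpose_mult_self_cancel:
  fixes D Y Z :: "real mat"
  assumes D: "D \<in> carrier_mat r c" and Y: "Y \<in> carrier_mat c k" and Z: "Z \<in> carrier_mat c k"
    and eq: "D\<^sup>T * D * Y = D\<^sup>T * D * Z"
  shows "D * Y = D * Z"
proof -
  have DT: "D\<^sup>T \<in> carrier_mat c r" using D by simp
  have E: "D * Y - D * Z \<in> carrier_mat r k"
    by (intro minus_carrier_mat mult_carrier_mat[OF D Z])
  have "D\<^sup>T * (D * Y - D * Z) = D\<^sup>T * (D * Y) - D\<^sup>T * (D * Z)"
    using D Y Z by (intro mult_minus_distrib_mat) auto
  also have "\<dots> = 0\<^sub>m c k"
    using eq D Y Z by (simp add: assoc_mult_mat_dim)
  finally have 0: "D\<^sup>T * (D * Y - D * Z) = 0\<^sub>m c k" .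
  have "(D * Y - D * Z)\<^sup>T = (D * (Y - Z))\<^sup>T"
    using mult_minus_distrib_mat[OF D Y Z] by simp
  also have "\<dots> = (Y - Z)\<^sup>T * D\<^sup>T" using D Y Z by (simp add: transpose_mult_dim)
  finally have "(D * Y - D * Z)\<^sup>T * (D * Y - D * Z) = (Y - Z)\<^sup>T * (D\<^sup>T * (D * Y - D * Z))"
    using D Y Z by (simp add: assoc_mult_mat_dim)
  also have "\<dots> = 0\<^sub>m k k" unfolding 0 using Y Z by (intro right_mult_zero_mat) auto
  finally have "D * Y - D * Z = 0\<^sub>m r k" by (rule transpose_mult_self_eq_0[OF E])
  hence *: "(D * Y - D * Z) $$ (i, j) = 0\<^sub>m r k $$ (i, j)" for i j by simp
  show ?thesis
  proof (rule eq_matI)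
    fix i j assume "i < dim_row (D * Z)" "j < dim_col (D * Z)"
    thus "(D * Y) $$ (i, j) = (D * Z) $$ (i, j)"
      using *[of i j] D Y Z by (simp del: index_mult_mat(1))
  qed (use D Y Z in auto)
qed

section \<open>Generalized inverses by row reduction\<close>

text \<open>Pivot columns of a reduced echelon form are unit vectors. Selecting them by
  \<open>X\<close> makes \<open>R * X\<close> the diagonal 0/1 matrix that keeps exactly the nonzero
  rows of \<open>R\<close>.\<close>

lemma row_echelon_form_generalized_inverse:
  fixes R :: "'a :: semiring_1 mat"
  assumes R: "R \<in> carrier_mat r c" and ech: "row_echelon_form R"
  obtains X where "X \<in> carrier_mat c r" "R * X * R = R"
proof -
  obtain f where f: "pivot_fun R f c" using ech R by (auto simp: row_echelon_form_def)
  note piv = pivot_funD[OF carrier_matD(1)[OF R] f]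
  define X :: "'a mat" where "X = mat c r (\<lambda>(j, i). if j = f i then 1 else 0)"
  have X: "X \<in> carrier_mat c r" by (simp add: X_def)
  have RX: "(R * X) $$ (i, k) = (if i = k \<and> f k < c then 1 else 0)" if "i < r" "k < r" for i k
  proof -
    have "(R * X) $$ (i, k) = (\<Sum>j = 0..<c. R $$ (i, j) * (if j = f k then 1 else 0))"
      using R that by (simp add: X_def scalar_prod_def del: sum.delta)
    also have "\<dots> = (\<Sum>j = 0..<c. if j = f k then R $$ (i, j) else 0)"
      by (intro sum.cong) auto
    also have "\<dots> = (if f k < c then R $$ (i, f k) else 0)" by simp
    finally show ?thesis using piv(4,5)[of k] that by auto
  qed
  have "R * X * R = R"
  proof (rule eq_matI)
    fix i j assume "i < dim_row R" "j < dim_col R"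
    hence ij: "i < r" "j < c" using R by auto
    have "(R * X * R) $$ (i, j) = (\<Sum>k = 0..<r. (R * X) $$ (i, k) * R $$ (k, j))"
      using R X ij by (simp add: scalar_prod_def del: assoc_mult_mat)
    also have "\<dots> = (\<Sum>k = 0..<r. if k = i then if f i < c then R $$ (i, j) else 0 else 0)"
      using ij by (intro sum.cong) (auto simp: RX)
    also have "\<dots> = (if f i < c then R $$ (i, j) else 0)" using ij by simp
    \<comment> \<open>A row without pivot has \<open>f i = c\<close>, and all its entries in columns
      before \<open>f i\<close> vanish.\<close>
    also have "\<dots> = R $$ (i, j)" using piv(1,2)[of i] ij by fastforce
    finally show "(R * X * R) $$ (i, j) = R $$ (i, j)" .
  qed (use R X in auto)
  with X show thesis by (rule that)
qed

text \<open>Gauss-Jordan elimination gives an echelon form \<open>P * G\<close> with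
  \<open>P\<close> invertible. If \<open>X\<close> serves for \<open>P * G\<close>, then
  \<open>X * P\<close> serves for \<open>G\<close>, after cancelling \<open>P\<close> on the left by
  means of \<open>Q\<close>.\<close>

lemma ex_generalized_inverse:
  fixes G :: "'a :: field mat"
  assumes G: "G \<in> carrier_mat r c"
  obtains X where "X \<in> carrier_mat c r" "G * X * G = G"
proof -
  note gj = gauss_jordan_single[OF G refl]
  obtain P Q where R: "gauss_jordan_single G = P * G" and P: "P \<in> carrier_mat r r"
    and Q: "Q \<in> carrier_mat r r" and QP: "Q * P = 1\<^sub>m r"
    using gj(4) by blast
  obtain X where X: "X \<in> carrier_mat c r" and eq: "P * G * X * (P * G) = P * G"
    using row_echelon_form_generalized_inverse[OF gj(2,3)] unfolding R by blast
  have *: "Q * (P * Z) = Z" if "Z \<in> carrier_mat r k" for Z k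
    using QP that P Q by (simp flip: assoc_mult_mat)
  have "G * (X * P) * G = Q * (P * (G * (X * P) * G))"
    using G X P by (intro *[symmetric]) auto
  also have "\<dots> = Q * (P * G * X * (P * G))" using G X P Q by (simp add: assoc_mult_mat_dim)
  also have "\<dots> = G" unfolding eq by (rule *[OF G])
  finally show thesis using X P by (intro that[of "X * P"]) auto
qed

text \<open>The witness is \<open>Y * G\<^sup>T\<close> with \<open>Y\<close> a generalized inverse
  of \<open>G\<^sup>T * G\<close>, as in the normal equations.\<close>

lemma ex_least_squares_inverse:
  fixes G :: "real mat"
  assumes G: "G \<in> carrier_mat r c"
  obtains X where "X \<in> carrier_mat c r" "G * X * G = G" "(G * X)\<^sup>T = G * X"
proof -
  have "G\<^sup>T * G \<in> carrier_mat c c" using G by simp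
  then obtain Y where Y: "Y \<in> carrier_mat c c" and eq: "G\<^sup>T * G * Y * (G\<^sup>T * G) = G\<^sup>T * G"
    by (rule ex_generalized_inverse)
  have "G * (Y * (G\<^sup>T * G)) = G * 1\<^sub>m c"
    by (rule transpose_mult_self_cancel[OF G]) (use G Y eq in \<open>auto simp: assoc_mult_mat_dim\<close>)
  hence *: "G * (Y * G\<^sup>T) * G = G" using G Y by (simp add: assoc_mult_mat_dim)
  define E where "E = G * (Y * G\<^sup>T)"
  have E: "E \<in> carrier_mat r r" and EG: "E * G = G" using G Y * by (auto simp: E_def)
  have ET: "E\<^sup>T = G * (Y\<^sup>T * G\<^sup>T)"
    using G Y by (simp add: E_def transpose_mult_dim assoc_mult_mat_dim)
  \<comment> \<open>\<open>Y\<close> need not be symmetric. Since \<open>E\<close> fixes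
    \<open>G\<close>, it fixes \<open>E\<^sup>T\<close>, so
    \<open>E\<^sup>T = E * E\<^sup>T\<close>, which is symmetric.\<close>
  have "E * E\<^sup>T = E * G * (Y\<^sup>T * G\<^sup>T)"
    unfolding ET using E G Y by (simp add: assoc_mult_mat_dim)
  hence EET: "E * E\<^sup>T = E\<^sup>T" by (simp add: EG ET)
  have "E = (E * E\<^sup>T)\<^sup>T" unfolding EET by simp
  also have "\<dots> = E * E\<^sup>T" using E transpose_mult[of E r r "E\<^sup>T" r] by simp
  finally have "E\<^sup>T = E" by (simp only: EET)
  thus thesis using * G Y by (intro that[of "Y * G\<^sup>T"]) (auto simp: E_def)
qed

section \<open>Existence and uniqueness of the Moore-Penrose inverse\<close>

text \<open>Take generalized inverses \<open>L\<close> with \<open>G * L\<close> symmetric and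
  \<open>K\<close> with \<open>K * G\<close> symmetric, the latter by transposing the construction
  for \<open>G\<^sup>T\<close>. Then \<open>X = K * G * L\<close> inherits both symmetries, as
  \<open>G * X = G * L\<close> and \<open>X * G = K * G\<close>.\<close>

lemma ex_is_pseudo_inverse: "\<exists>X. is_pseudo_inverse G X"
proof -
  define r c where "r = dim_row G" and "c = dim_col G"
  have G: "G \<in> carrier_mat r c" by (simp add: r_def c_def)
  obtain L where L: "L \<in> carrier_mat c r" "G * L * G = G" "(G * L)\<^sup>T = G * L"
    using ex_least_squares_inverse[OF G] .
  have "G\<^sup>T \<in> carrier_mat c r" using G by simp
  then obtain Z where Z: "Z \<in> carrier_mat r c" "G\<^sup>T * Z * G\<^sup>T = G\<^sup>T" "(G\<^sup>T * Z)\<^sup>T = G\<^sup>T * Z"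
    by (rule ex_least_squares_inverse)
  define K where "K = Z\<^sup>T"
  have K: "K \<in> carrier_mat c r" using Z by (simp add: K_def)
  have "(G\<^sup>T * Z * G\<^sup>T)\<^sup>T = G" unfolding Z(2) by simp
  hence GKG: "G * K * G = G" using G Z(1) by (simp add: K_def transpose_mult_dim assoc_mult_mat_dim)
  have KG: "(K * G)\<^sup>T = K * G" using Z(3) G Z(1) by (simp add: K_def transpose_mult_dim)
  define X where "X = K * G * L"
  have X: "X \<in> carrier_mat c r" using K G L by (simp add: X_def)
  have GX: "G * X = G * L"
  proof -
    have "G * X = G * K * G * L" using G K L by (simp add: X_def assoc_mult_mat_dim)
    thus ?thesis by (simp add: GKG)
  qed
  have XG: "X * G = K * G"
  proof -
    have "X * G = K * (G * L * G)" using G K L by (simp add: X_def assoc_mult_mat_dim)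
    thus ?thesis by (simp add: L)
  qed
  have "X * G * X = K * (G * K * G) * L"
    unfolding XG using G K L by (simp add: X_def assoc_mult_mat_dim)
  hence "X * G * X = X" by (simp add: GKG X_def)
  hence "is_pseudo_inverse G X"
    using X G L KG GX XG by (simp add: is_pseudo_inverse_def)
  thus ?thesis ..
qed

text \<open>Symmetry allows the projections to be swapped, giving \<open>G * X = G * Y\<close> and
  \<open>X * G = Y * G\<close>; then
  \<open>X = X * G * X = X * G * Y = Y * G * Y = Y\<close>.\<close>

lemma is_pseudo_inverse_unique:
  assumes X: "is_pseudo_inverse G X" and Y: "is_pseudo_inverse G Y"
  shows "X = Y"
proof -
  have dim [simp]: "dim_row X = dim_col G" "dim_col X = dim_row G"
      "dim_row Y = dim_col G" "dim_col Y = dim_row G"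
    using X Y by (auto simp: is_pseudo_inverse_def)
  have X': "G * X * G = G" "X * G * X = X" "(G * X)\<^sup>T = G * X" "(X * G)\<^sup>T = X * G"
    and Y': "G * Y * G = G" "Y * G * Y = Y" "(G * Y)\<^sup>T = G * Y" "(Y * G)\<^sup>T = Y * G"
    using X Y by (auto simp: is_pseudo_inverse_def)
  have "G * X = (G * Y * G) * X" by (simp only: Y')
  also have "\<dots> = (G * Y)\<^sup>T * (G * X)\<^sup>T" unfolding X'(3) Y'(3) by (simp add: assoc_mult_mat_dim)
  also have "\<dots> = (G * X * G * Y)\<^sup>T"
    by (subst transpose_mult_dim[symmetric]) (simp_all add: assoc_mult_mat_dim)
  also have "\<dots> = G * Y" by (simp add: X' Y')
  finally have GX: "G * X = G * Y" .
  have "X * G = X * (G * Y * G)" by (simp add: Y')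
  also have "\<dots> = (X * G)\<^sup>T * (Y * G)\<^sup>T" unfolding X'(4) Y'(4) by (simp add: assoc_mult_mat_dim)
  also have "\<dots> = (Y * (G * X * G))\<^sup>T"
    by (subst transpose_mult_dim[symmetric]) (simp_all add: assoc_mult_mat_dim)
  also have "\<dots> = Y * G" by (simp add: X' Y')
  finally have XG: "X * G = Y * G" .
  have "X = X * (G * X)" using X' by (simp add: assoc_mult_mat_dim)
  also have "\<dots> = X * G * Y" by (simp add: GX assoc_mult_mat_dim)
  also have "\<dots> = Y" by (simp add: XG Y')
  finally show ?thesis .
qed

lemma is_pseudo_inverse_pseudo_inverse: "is_pseudo_inverse G (pseudo_inverse G)"
  unfolding pseudo_inverse_def
  by (rule theI'[OF ex_ex1I[OF ex_is_pseudo_inverse is_pseudo_inverse_unique]])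

lemma gram_mult_pseudo_inverse_mult_transpose:
  fixes D :: "real mat"
  shows "D\<^sup>T * D * pseudo_inverse (D\<^sup>T * D) * D\<^sup>T = D\<^sup>T"
proof -
  define r c where "r = dim_row D" and "c = dim_col D"
  have D: "D \<in> carrier_mat r c" by (simp add: r_def c_def)
  define M where "M = D\<^sup>T * D"
  define E where "E = M * pseudo_inverse M"
  have M: "M \<in> carrier_mat c c" using D by (simp add: M_def)
  have EM: "E * M = M" and ET: "E\<^sup>T = E" and E: "E \<in> carrier_mat c c"
    using is_pseudo_inverse_pseudo_inverse[of M] M by (auto simp: is_pseudo_inverse_def E_def)
  have MT: "M\<^sup>T = M" using D by (simp add: M_def transpose_mult_dim)
  \<comment> \<open>Transposition moves \<open>E\<close> to the right of \<open>M\<close>, where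
    \<open>D\<^sup>T\<close> can be cancelled on the left.\<close>
  have "M * E = (E * M)\<^sup>T" using M E by (simp add: transpose_mult_dim MT ET)
  also have "\<dots> = M" by (simp add: EM MT)
  finally have "D\<^sup>T * D * E = D\<^sup>T * D * 1\<^sub>m c" using M by (simp flip: M_def)
  hence "D * E = D * 1\<^sub>m c" by (intro transpose_mult_self_cancel[OF D E]) auto
  hence "(D * E)\<^sup>T = D\<^sup>T" using D by simp
  hence "E * D\<^sup>T = D\<^sup>T" using D E by (simp add: transpose_mult_dim ET)
  thus ?thesis by (simp add: E_def M_def)
qed

theorem corollary3p3:
  fixes A B W :: "real mat" and S :: "nat \<Rightarrow> real mat"
    and b :: "real vec" and x p :: "nat \<Rightarrow> real vec" and m n q :: nat
  assumes A: "A \<in> carrier_mat m n" and "m < n"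
    and b: "b \<in> (\<lambda>z. A *\<^sub>v z) ` carrier_vec n"
    and B: "B \<in> carrier_mat q n" "invertible_mat (B\<^sup>T * B)"
    and W: "W \<in> carrier_mat n n" "inverts_mat (B\<^sup>T * B) W" "inverts_mat W (B\<^sup>T * B)"
    and S: "\<And>k. k \<in> {1..m - 1} \<Longrightarrow> S k \<in> carrier_mat m k"
    and S_full_rank: "\<And>k. k \<in> {1..m - 1} \<Longrightarrow> vec_space.rank m (S k) = k"
    and Sm: "S m \<in> carrier_mat m m" "invertible_mat (S m)"
    and x0: "x 0 \<in> carrier_vec n"
    and x: "\<And>k. k \<in> {1..m} \<Longrightarrow> x k = x (k - 1) + p k"
    and p: "\<And>k. k \<in> {1..m} \<Longrightarrow>
      p k = (W * A\<^sup>T * S k * pseudo_inverse ((S k)\<^sup>T * A * W * A\<^sup>T * S k) * (S k)\<^sup>T)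
              *\<^sub>v (b - A *\<^sub>v x (k - 1))"
  shows "A *\<^sub>v x m = b"
proof (cases "m = 0")
  case True
  \<comment> \<open>There is no step for \<open>m = 0\<close>, but both sides are then empty
    vectors.\<close>
  have "dim_vec (A *\<^sub>v x m) = 0" "dim_vec b = 0" using A b True by auto
  thus ?thesis by auto
next
  case False
  define y where "y = x (m - 1)"
  \<comment> \<open>The length of \<open>p k\<close> is the row count of \<open>W\<close>, whatever
    the length of \<open>x (k - 1)\<close>, so the induction below is not circular.\<close>
  have dim_p: "k \<in> {1..m} \<Longrightarrow> p k \<in> carrier_vec n" for k
    by (subst p) (use W in \<open>auto intro!: carrier_vecI\<close>)
  have "k \<le> m \<Longrightarrow> x k \<in> carrier_vec n" for k
  proof (induction k)
    case (Suc k)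
    thus ?case using x[of "Suc k"] dim_p[of "Suc k"] by auto
  qed (simp add: x0)
  hence y: "y \<in> carrier_vec n" by (simp add: y_def)
  obtain z where z: "z \<in> carrier_vec n" "b = A *\<^sub>v z" using b by auto
  define v where "v = z - y"
  have v: "v \<in> carrier_vec n" using z y by (simp add: v_def)
  have res: "b - A *\<^sub>v y = A *\<^sub>v v"
    using A z y by (simp add: v_def mult_minus_distrib_mat_vec)

  \<comment> \<open>Factorization of the Gram matrix\<close>
  define C where "C = A\<^sup>T * S m"
  \<comment> \<open>The factor \<open>B * W\<close> is a square root of \<open>W\<close> in the
    sense that \<open>(B * W)\<^sup>T * (B * W) = W\<close>. Hence \<open>D\<^sup>T * D\<close> is
    the matrix whose pseudo-inverse occurs in \<open>p m\<close>.\<close>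
  define D where "D = B * W * C"
  define N where "N = pseudo_inverse (D\<^sup>T * D)"
  have C: "C \<in> carrier_mat n m" using A Sm by (simp add: C_def)
  have D: "D \<in> carrier_mat q m" using B W C by (simp add: D_def)
  have N: "N \<in> carrier_mat m m"
    using is_pseudo_inverse_pseudo_inverse[of "D\<^sup>T * D"] D
    by (simp add: is_pseudo_inverse_def N_def)
  have BBW: "B\<^sup>T * (B * W) = 1\<^sub>m n"
    using W B by (simp add: inverts_mat_def assoc_mult_mat_dim)
  have WTBB: "W\<^sup>T * (B\<^sup>T * B) = 1\<^sub>m n"
  proof -
    have "W\<^sup>T * (B\<^sup>T * B) = (B\<^sup>T * (B * W))\<^sup>T"
      using B W by (simp add: transpose_mult_dim assoc_mult_mat_dim)
    thus ?thesis by (simp add: BBW)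
  qed
  \<comment> \<open>A left inverse and a right inverse of \<open>B\<^sup>T * B\<close>
    coincide.\<close>
  have WT: "W\<^sup>T = W"
  proof -
    have "W\<^sup>T = W\<^sup>T * (B\<^sup>T * (B * W))" using W by (simp add: BBW)
    also have "\<dots> = W\<^sup>T * (B\<^sup>T * B) * W" using B W by (simp add: assoc_mult_mat_dim)
    also have "\<dots> = W" using W by (simp add: WTBB)
    finally show ?thesis .
  qed
  have DTB: "D\<^sup>T * B = C\<^sup>T"
  proof -
    have "D\<^sup>T * B = C\<^sup>T * (W\<^sup>T * (B\<^sup>T * B))"
      using B W C by (simp add: D_def transpose_mult_dim assoc_mult_mat_dim)
    thus ?thesis using C by (simp add: WTBB)
  qed
  have gram: "D\<^sup>T * D = C\<^sup>T * (W * C)"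
  proof -
    have "D\<^sup>T * D = D\<^sup>T * B * (W * C)"
      using B W C D by (simp add: D_def assoc_mult_mat_dim)
    thus ?thesis by (simp add: DTB)
  qed
  have CT: "C\<^sup>T = (S m)\<^sup>T * A" using A Sm by (simp add: C_def transpose_mult_dim)
  have fix_CT: "C\<^sup>T * (W * (C * (N * C\<^sup>T))) = C\<^sup>T"
  proof -
    have "D\<^sup>T * D * N * D\<^sup>T * B = C\<^sup>T"
      unfolding N_def gram_mult_pseudo_inverse_mult_transpose by (rule DTB)
    hence "D\<^sup>T * D * (N * (D\<^sup>T * B)) = C\<^sup>T"
      using D N B by (simp add: assoc_mult_mat_dim)
    thus ?thesis unfolding DTB gram using C N W by (simp add: assoc_mult_mat_dim)
  qed

  \<comment> \<open>The last step and cancellation of \<open>S m\<close>\<close>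
  have M: "(S m)\<^sup>T * A * W * A\<^sup>T * S m = D\<^sup>T * D"
    unfolding gram CT using A W Sm by (simp add: C_def assoc_mult_mat_dim)
  have "p m = (W * A\<^sup>T * S m * N * (S m)\<^sup>T) *\<^sub>v (b - A *\<^sub>v x (m - 1))"
    using p[of m] False unfolding M N_def by simp
  also have "\<dots> = (W * A\<^sup>T * S m * N * (S m)\<^sup>T) *\<^sub>v (A *\<^sub>v v)"
    using res by (simp add: y_def)
  also have "\<dots> = (W * A\<^sup>T * S m * N * (S m)\<^sup>T * A) *\<^sub>v v"
    using A W Sm N v by (intro assoc_mult_mat_vec[symmetric]) auto
  also have "W * A\<^sup>T * S m * N * (S m)\<^sup>T * A = W * (C * (N * C\<^sup>T))"
    unfolding CT using A W Sm N by (simp add: C_def assoc_mult_mat_dim)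
  finally have pm: "p m = (W * (C * (N * C\<^sup>T))) *\<^sub>v v" .
  have pm_carrier: "p m \<in> carrier_vec n" using dim_p[of m] False by simp
  have "(S m)\<^sup>T *\<^sub>v (A *\<^sub>v p m) = C\<^sup>T *\<^sub>v p m"
    unfolding CT using A Sm pm_carrier by (intro assoc_mult_mat_vec[symmetric]) auto
  also have "\<dots> = (C\<^sup>T * (W * (C * (N * C\<^sup>T)))) *\<^sub>v v"
    unfolding pm using C W N v by (intro assoc_mult_mat_vec[symmetric]) auto
  also have "\<dots> = C\<^sup>T *\<^sub>v v" by (simp only: fix_CT)
  also have "\<dots> = (S m)\<^sup>T *\<^sub>v (A *\<^sub>v v)"
    unfolding CT using A Sm v by (intro assoc_mult_mat_vec) auto
  finally have S_eq: "(S m)\<^sup>T *\<^sub>v (A *\<^sub>v p m) = (S m)\<^sup>T *\<^sub>v (A *\<^sub>v v)" .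

  obtain T where T: "S m * T = 1\<^sub>m m" "T * S m = 1\<^sub>m (dim_row T)"
    using Sm by (auto simp: invertible_mat_def inverts_mat_def)
  \<comment> \<open>Invertibility yields \<open>T\<close> without a carrier; its dimensions are read
    off from the two products.\<close>
  have T_carrier: "T \<in> carrier_mat m m"
    using arg_cong[OF T(1), of dim_col] arg_cong[OF T(2), of dim_col] Sm(1) by auto
  have TS: "T\<^sup>T * (S m)\<^sup>T = 1\<^sub>m m"
    using T(1) transpose_mult[OF Sm(1) T_carrier] by simp
  have cancel: "T\<^sup>T *\<^sub>v ((S m)\<^sup>T *\<^sub>v u) = u" if "u \<in> carrier_vec m" for u
    using TS T_carrier Sm(1) that by (simp flip: assoc_mult_mat_vec)
  have "A *\<^sub>v p m = T\<^sup>T *\<^sub>v ((S m)\<^sup>T *\<^sub>v (A *\<^sub>v p m))"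
    using A pm_carrier by (intro cancel[symmetric]) auto
  also have "\<dots> = A *\<^sub>v v" unfolding S_eq using A v by (intro cancel) auto
  finally have "A *\<^sub>v p m = A *\<^sub>v v" .
  moreover have "x m = y + p m" using x[of m] False by (simp add: y_def)
  ultimately have "A *\<^sub>v x m = A *\<^sub>v y + A *\<^sub>v v"
    using A y pm_carrier by (simp add: mult_add_distrib_mat_vec)
  also have "\<dots> = A *\<^sub>v (y + v)" using A y v by (simp add: mult_add_distrib_mat_vec)
  also have "y + v = z" using y z by (auto simp: v_def)
  finally show ?thesis by (simp add: z)
qed

end
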